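(* Let $p$ be a fixed odd prime, let $q\in\mathbb{C}_p$ with $|q-1|_p<1$, and let the $q$-Euler numbers $\widetilde{E}_{n,q}$ ($n\ge 0$) be defined by $$\frac{[2]_q}{qe^{t}+1}=\sum_{n=0}^{\infty}\widetilde{E}_{n,q}\frac{t^n}{n!},\qquad [2]_q=1+q.$$ Then for all natural numbers $m,k$, $$\sum_{j=0}^{\max\{k,m\}}\left[q\binom{k}{j}+(-1)^j\binom{m}{j}\right]\sum_{l=0}^{k+m-j}\binom{k+m-j}{l}\widetilde{E}_{k+m-j-l,q}\,\widetilde{E}_{l,q} =[2]_q\sum_{l=0}^{m}\binom{m}{l}(-1)^{m-l}\widetilde{E}_{l+k,q}.$$
   Context: $\mathbb{C}_p$ is the completion of an algebraic closure of $\mathbb{Q}_p$, and $|\cdot|_p$ is the $p$-adic absolute value with $|p|_p=1/p$. The generating function is a formal power series in $t$. Binomial coefficients $\binom{a}{j}$ with $j>a\ge0$ are $0$. Equivalently, $\widetilde{E}_{n,q}=\int_{\mathbb{Z}_p}y^n\,d\mu_{-q}(y)$, where $\int_{\mathbb{Z}_p}f\,d\mu_{-q}$ is Kim's fermionic $p$-adic $q$-integral. *)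

theory Defs
  imports
    "HOL-Analysis.Abstract_Metric_Spaces"
    "HOL-Computational_Algebra.Formal_Power_Series"
    "HOL-Computational_Algebra.Polynomial"
    "HOL-Computational_Algebra.Primes"
begin

definition is_subfield :: "'a::field set \<Rightarrow> bool" where
  "is_subfield K \<longleftrightarrow>
     0 \<in> K \<and> 1 \<in> K \<and>
     (\<forall>x\<in>K. \<forall>y\<in>K. x + y \<in> K \<and> x * y \<in> K) \<and>
     (\<forall>x\<in>K. - x \<in> K \<and> inverse x \<in> K)"

definition is_algebraic_closure_of :: "'a::field set \<Rightarrow> 'a set \<Rightarrow> bool" where
  "is_algebraic_closure_of K L \<longleftrightarrow>
     is_subfield K \<and> is_subfield L \<and> K \<subseteq> L \<and>
     (\<forall>x\<in>L. \<exists>f. f \<noteq> 0 \<and> set (coeffs f) \<subseteq> K \<and> poly f x = 0) \<and>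
     (\<forall>f. set (coeffs f) \<subseteq> L \<and> degree f > 0 \<longrightarrow> (\<exists>x\<in>L. poly f x = 0))"

locale nonarch_absolute_value =
  fixes v :: "'a::field \<Rightarrow> real"
  assumes nonneg: "0 \<le> v x"
    and eq_0_iff: "v x = 0 \<longleftrightarrow> x = 0"
    and mult: "v (x * y) = v x * v y"
    and ultrametric: "v (x + y) \<le> max (v x) (v y)"
begin

definition vdist :: "'a \<Rightarrow> 'a \<Rightarrow> real" where
  "vdist x y = v (x - y)"

definition is_completion_of :: "'a set \<Rightarrow> 'a set \<Rightarrow> bool" where
  "is_completion_of A B \<longleftrightarrow>
     A \<subseteq> B \<and> Metric_space.mcomplete B vdist \<and>
     B \<subseteq> Metric_space.mtopology UNIV vdist closure_of A"

lemma v_one: "v 1 = 1"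
  using mult[of 1 1] eq_0_iff[of 1] by simp

lemma v_minus: "v (- x) = v x"
proof -
  have "v (- 1) * v (- 1) = 1"
    using mult[of "- 1" "- 1"] v_one by simp
  then have "v (- 1) = 1"
    using nonneg[of "- 1"] by (metis abs_of_nonneg real_sqrt_abs2 real_sqrt_one)
  then show ?thesis
    using mult[of "- 1" x] by simp
qed

lemma Metric_space_vdist: "Metric_space S vdist"
proof
  fix x y z :: 'a
  show "0 \<le> vdist x y"
    by (simp add: vdist_def nonneg)
  show "vdist x y = vdist y x"
    using v_minus[of "x - y"] by (simp add: vdist_def)
  show "vdist x y = 0 \<longleftrightarrow> x = y"
    by (simp add: vdist_def eq_0_iff)
  show "vdist x z \<le> vdist x y + vdist y z"
    using ultrametric[of "x - y" "y - z"] nonneg[of "x - y"] nonneg[of "y - z"]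
    by (simp add: vdist_def)
qed

end

text \<open>
  The type \<open>'a\<close> with the absolute value \<open>v\<close> is a copy of \<open>\<complex>\<^sub>p\<close>.  Since this field is only defined
  up to isometric isomorphism, it is described by the tower of extensions that defines it, all
  realised as subfields of \<open>'a\<close>.  On the prime field, \<open>v\<close> being nonarchimedean and \<open>v p = 1 / p\<close>
  force \<open>v\<close> to be the \<open>p\<close>-adic absolute value.
\<close>

locale padic_complex_field = nonarch_absolute_value v
  for p :: nat and v :: "'a::field_char_0 \<Rightarrow> real" +
  assumes prime_p: "prime p"
    and v_p: "v (of_nat p) = 1 / real p"
    and tower: "\<exists>Qp Qp_bar. is_completion_of \<rat> Qp \<and>
                  is_algebraic_closure_of Qp Qp_bar \<and>
                  is_completion_of Qp_bar UNIV"

definition q_Euler :: "'a::field_char_0 \<Rightarrow> nat \<Rightarrow> 'a" where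
  "q_Euler q n = fact n * fps_nth (fps_const (1 + q) / (fps_const q * fps_exp 1 + 1)) n"

lemma q_Euler_generating_function:
  "fps_const (1 + q) / (fps_const q * fps_exp 1 + 1) = Abs_fps (\<lambda>n. q_Euler q n / fact n)"
  by (rule fps_ext) (simp add: q_Euler_def)

end

theory Submission
  imports Defs
begin

text \<open>
  Let \<open>F = (1 + q) / (q e\<^sup>t + 1)\<close>, and let \<open>E\<close> and \<open>L\<close> be the linear functionals on polynomials that
  send \<open>x\<^sup>n\<close> to \<open>n!\<close> times the \<open>n\<close>-th coefficient of \<open>F\<close> and of \<open>F\<^sup>2\<close>, respectively. The identity
  \<open>(q e\<^sup>t + 1) F\<^sup>2 = (1 + q) F\<close> says that \<open>L (q f(x + 1) + f(x)) = (1 + q) E f\<close> for all \<open>f\<close>. For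
  \<open>f = x\<^sup>k (x - 1)\<^sup>m\<close> the shifted polynomial is \<open>(x + 1)\<^sup>k x\<^sup>m\<close>, and expanding both sides by the binomial
  theorem gives the claim.
\<close>

definition umbral :: "(nat \<Rightarrow> 'a) \<Rightarrow> 'a::comm_ring_1 poly \<Rightarrow> 'a" where
  "umbral a f = (\<Sum>i\<le>degree f. coeff f i * a i)"

text \<open>Coefficients beyond the degree vanish, so polynomials of different degrees can be summed
  over one common range; additivity rests on this.\<close>

lemma umbral_altdef:
  assumes "degree f \<le> N"
  shows "umbral a f = (\<Sum>i\<le>N. coeff f i * a i)"
  unfolding umbral_def using assms
  by (intro sum.mono_neutral_left) (auto simp: coeff_eq_0)

lemma umbral_0: "umbral a 0 = 0"
  by (simp add: umbral_def)

lemma umbral_add: "umbral a (f + g) = umbral a f + umbral a g"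
proof -
  define N where "N = max (degree f) (degree g)"
  have "degree (f + g) \<le> N"
    by (simp add: N_def degree_add_le_max)
  then show ?thesis
    by (simp add: umbral_altdef[of _ N] N_def sum.distrib distrib_right)
qed

lemma umbral_smult: "umbral a (smult c f) = c * umbral a f"
  unfolding umbral_altdef[OF degree_smult_le] umbral_def[of a f]
  by (simp add: sum_distrib_left mult.assoc)

lemma umbral_sum: "umbral a (sum f A) = (\<Sum>i\<in>A. umbral a (f i))"
  by (induction A rule: infinite_finite_induct) (simp_all add: umbral_0 umbral_add)

lemma umbral_monom: "umbral a (monom c n) = c * a n"
proof -
  have "umbral a (monom c n) = (\<Sum>i\<le>n. coeff (monom c n) i * a i)"
    by (rule umbral_altdef) (rule degree_monom_le)
  also have "\<dots> = (\<Sum>i\<le>n. if i = n then c * a n else 0)"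
    by (rule sum.cong) auto
  finally show ?thesis
    by simp
qed

lemma pcompose_power: "(f ^ n) \<circ>\<^sub>p g = (f \<circ>\<^sub>p g) ^ n"
  by (induction n) (simp_all add: pcompose_1 pcompose_mult)

text \<open>The binomial theorem with \<open>j\<close> counting the factors \<open>c\<close>, so
  that the exponents descend as \<open>k + m - j\<close>, as in the claim. It serves for both
  \<open>c = 1\<close> and \<open>c = - 1\<close>.\<close>

lemma monom_times_binomial:
  fixes c :: "'a::comm_ring_1"
  shows "monom 1 m * [:c, 1:] ^ k = (\<Sum>j\<le>k. monom (of_nat (k choose j) * c ^ j) (k + m - j))"
proof -
  have "[:c, 1:] = [:c:] + monom 1 1"
    by (simp add: monom_Suc)
  then have "monom 1 m * [:c, 1:] ^ k
      = (\<Sum>j\<le>k. monom 1 m * (of_nat (k choose j) * [:c:] ^ j * monom 1 1 ^ (k - j)))"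
    by (simp only: binomial_ring sum_distrib_left)
  also have "\<dots> = (\<Sum>j\<le>k. monom (of_nat (k choose j) * c ^ j) (k + m - j))"
  proof (rule sum.cong)
    fix j assume "j \<in> {..k}"
    then show "monom 1 m * (of_nat (k choose j) * [:c:] ^ j * monom 1 1 ^ (k - j))
        = monom (of_nat (k choose j) * c ^ j) (k + m - j)"
      by (simp add: of_nat_poly monom_power poly_const_pow smult_monom mult_monom
          add.commute)
  qed simp
  finally show ?thesis .
qed

text \<open>The free bound \<open>N\<close> lets expansions with different exponents share the range
  up to \<open>max k m\<close>. For \<open>j > k\<close> the binomial coefficient is 0, so
  truncation in \<open>k + m - j\<close> is harmless.\<close>

lemma umbral_monom_times_binomial:
  fixes c :: "'a::comm_ring_1"
  assumes "k \<le> N"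
  shows "umbral a (monom 1 m * [:c, 1:] ^ k)
    = (\<Sum>j = 0..N. of_nat (k choose j) * c ^ j * a (k + m - j))"
proof -
  have "umbral a (monom 1 m * [:c, 1:] ^ k)
    = (\<Sum>j\<le>k. of_nat (k choose j) * c ^ j * a (k + m - j))"
    by (simp add: monom_times_binomial umbral_sum umbral_monom)
  also have "\<dots> = (\<Sum>j = 0..N. of_nat (k choose j) * c ^ j * a (k + m - j))"
    using assms by (intro sum.mono_neutral_left) (simp_all add: binomial_eq_0 subset_eq)
  finally show ?thesis .
qed

text \<open>Binomial self-convolution: \<open>n!\<close> times the \<open>n\<close>-th coefficient
  of the square of the exponential generating function of \<open>a\<close>. For
  \<open>a = q_Euler q\<close> these are the moments of the functional \<open>L\<close>.\<close>

definition umbral_square :: "(nat \<Rightarrow> 'a) \<Rightarrow> nat \<Rightarrow> 'a::comm_ring_1" where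
  "umbral_square a n = (\<Sum>l = 0..n. of_nat (n choose l) * a (n - l) * a l)"

lemma egf_product:
  fixes a b :: "nat \<Rightarrow> 'a::field_char_0"
  shows "Abs_fps (\<lambda>n. a n / fact n) * Abs_fps (\<lambda>n. b n / fact n)
    = Abs_fps (\<lambda>n. (\<Sum>l = 0..n. of_nat (n choose l) * a l * b (n - l)) / fact n)"
  by (rule fps_ext)
    (auto simp: fps_mult_nth sum_divide_distrib binomial_fact field_simps intro!: sum.cong)

lemma q_Euler_egf_equation:
  "(fps_const q * fps_exp 1 + 1) * Abs_fps (\<lambda>n. q_Euler q n / fact n) = fps_const (1 + q)"
proof (cases "1 + q = 0")
  \<comment> \<open>The denominator has constant term 0 and is not a unit here, but the dividend is
    0, hence so is the quotient.\<close>
  case True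
  then show ?thesis
    by (simp flip: q_Euler_generating_function)
next
  case False
  \<comment> \<open>The constant term is \<open>q + 1\<close>, so the denominator is a unit and the
    division is exact.\<close>
  then have "fps_nth (fps_const q * fps_exp 1 + 1) 0 \<noteq> 0"
    by (simp add: add.commute)
  then have "is_unit (fps_const q * fps_exp 1 + 1)"
    by (simp only: fps_is_unit_iff not_False_eq_True)
  then have "(fps_const q * fps_exp 1 + 1) dvd fps_const (1 + q)"
    by (rule unit_imp_dvd)
  then show ?thesis
    by (simp flip: q_Euler_generating_function)
qed

text \<open>Comparison of the \<open>n\<close>-th coefficients in
  \<open>(q e^t + 1) F^2 = (1 + q) F\<close>; this is the shift identity for
  \<open>f = x^n\<close>.\<close>

lemma umbral_square_q_Euler_recurrence:
  "q * (\<Sum>i\<le>n. of_nat (n choose i) * umbral_square (q_Euler q) i) + umbral_square (q_Euler q) n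
    = (1 + q) * q_Euler q n"
proof -
  define F where "F = Abs_fps (\<lambda>n. q_Euler q n / fact n)"
  define G where "G = Abs_fps (\<lambda>n. umbral_square (q_Euler q) n / fact n)"
  have "G = F * F"
    by (simp add: G_def F_def egf_product umbral_square_def mult.commute mult.left_commute)
  then have "(fps_const q * fps_exp 1 + 1) * G = fps_const (1 + q) * F"
    using q_Euler_egf_equation[of q] by (simp add: F_def flip: mult.assoc)
  then have "fps_const q * (G * fps_exp 1) + G = fps_const (1 + q) * F"
    by (simp add: algebra_simps)
  \<comment> \<open>The series \<open>e^t\<close> is the exponential generating function of the
    constant sequence 1, so this product is a binomial transform.\<close>
  moreover have "G * fps_exp 1
      = Abs_fps (\<lambda>n. (\<Sum>l = 0..n. of_nat (n choose l) * umbral_square (q_Euler q) l) / fact n)"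
    using egf_product[of "umbral_square (q_Euler q)" "\<lambda>_. 1"]
    by (simp add: G_def fps_exp_def)
  ultimately have "fps_nth (fps_const q * Abs_fps (\<lambda>n. (\<Sum>l = 0..n. of_nat (n choose l)
        * umbral_square (q_Euler q) l) / fact n) + G) n = fps_nth (fps_const (1 + q) * F) n"
    by simp
  then have "(q * (\<Sum>l = 0..n. of_nat (n choose l) * umbral_square (q_Euler q) l)
      + umbral_square (q_Euler q) n) / fact n = (1 + q) * q_Euler q n / fact n"
    by (simp add: F_def G_def add_divide_distrib)
  then show ?thesis
    by (simp add: atMost_atLeast0)
qed

text \<open>Both sides are linear in \<open>f\<close>, so the recurrence for the powers of
  \<open>x\<close> suffices.\<close>

lemma umbral_square_q_Euler_shift:
  "q * umbral (umbral_square (q_Euler q)) (f \<circ>\<^sub>p [:1, 1:]) + umbral (umbral_square (q_Euler q)) f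
    = (1 + q) * umbral (q_Euler q) f"
proof -
  let ?L = "umbral (umbral_square (q_Euler q))"
  have monom: "q * ?L ([:1, 1:] ^ n) + umbral_square (q_Euler q) n = (1 + q) * q_Euler q n" for n
  proof -
    have "?L ([:1, 1:] ^ n) = (\<Sum>j\<le>n. of_nat (n choose j) * umbral_square (q_Euler q) (n - j))"
      using umbral_monom_times_binomial[of n n "umbral_square (q_Euler q)" 0 1]
      by (simp add: atMost_atLeast0)
    also have "\<dots> = (\<Sum>j\<le>n. of_nat (n choose j) * umbral_square (q_Euler q) j)"
      by (rule sum.reindex_bij_witness[of _ "\<lambda>j. n - j" "\<lambda>j. n - j"])
        (auto simp flip: binomial_symmetric)
    finally show ?thesis
      using umbral_square_q_Euler_recurrence[of q n] by simp
  qed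
  have "f \<circ>\<^sub>p [:1, 1:] = (\<Sum>i\<le>degree f. smult (coeff f i) ([:1, 1:] ^ i))"
    by (simp add: pcompose_altdef poly_altdef coeff_map_poly degree_map_poly)
  then have "?L (f \<circ>\<^sub>p [:1, 1:]) = (\<Sum>i\<le>degree f. coeff f i * ?L ([:1, 1:] ^ i))"
    by (simp add: umbral_sum umbral_smult)
  then have "q * ?L (f \<circ>\<^sub>p [:1, 1:]) + ?L f
      = (\<Sum>i\<le>degree f. coeff f i * (q * ?L ([:1, 1:] ^ i) + umbral_square (q_Euler q) i))"
    by (simp add: umbral_def[of _ f] sum_distrib_left sum.distrib distrib_left
        mult.left_commute)
  then show ?thesis
    unfolding monom by (simp add: umbral_def sum_distrib_left mult.left_commute)
qed

theorem theorem4: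
  fixes p :: nat and v :: "'a::field_char_0 \<Rightarrow> real" and q :: 'a and m k :: nat
  assumes "prime p" and "odd p"
    and "padic_complex_field p v"
    and "v (q - 1) < 1"
  shows "(\<Sum>j = 0..max k m.
            (q * of_nat (k choose j) + (- 1) ^ j * of_nat (m choose j)) *
            (\<Sum>l = 0..k + m - j.
               of_nat ((k + m - j) choose l) * q_Euler q (k + m - j - l) * q_Euler q l))
       = (1 + q) * (\<Sum>l = 0..m. of_nat (m choose l) * (- 1) ^ (m - l) * q_Euler q (l + k))"
proof -
  let ?S = "umbral_square (q_Euler q)"
  define f :: "'a poly" where "f = monom 1 k * [:- 1, 1:] ^ m"
  \<comment> \<open>The shift turns \<open>x - 1\<close> into \<open>x\<close> and \<open>x\<close>
    into \<open>x + 1\<close>, so \<open>k\<close> and \<open>m\<close> swap roles and both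
    expansions involve the same \<open>?S (k + m - j)\<close>.\<close>
  have shift: "f \<circ>\<^sub>p [:1, 1:] = monom 1 m * [:1, 1:] ^ k"
    by (simp add: f_def pcompose_mult pcompose_power monom_altdef pcompose_pCons mult.commute)
  have L_shift: "umbral ?S (f \<circ>\<^sub>p [:1, 1:])
      = (\<Sum>j = 0..max k m. of_nat (k choose j) * ?S (k + m - j))"
    unfolding shift using umbral_monom_times_binomial[of k "max k m" ?S m 1] by simp
  have L_f: "umbral ?S f
      = (\<Sum>j = 0..max k m. of_nat (m choose j) * (- 1) ^ j * ?S (k + m - j))"
    unfolding f_def using umbral_monom_times_binomial[of m "max k m" ?S k "- 1"]
    by (simp add: add.commute)
  have "umbral (q_Euler q) f
      = (\<Sum>j = 0..m. of_nat (m choose j) * (- 1) ^ j * q_Euler q (m + k - j))"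
    unfolding f_def by (rule umbral_monom_times_binomial) simp
  \<comment> \<open>Reversing the sum by \<open>l = m - j\<close> gives the sign and index of the
    claim.\<close>
  also have "\<dots> = (\<Sum>l = 0..m. of_nat (m choose l) * (- 1) ^ (m - l) * q_Euler q (l + k))"
    by (rule sum.reindex_bij_witness[of _ "\<lambda>j. m - j" "\<lambda>j. m - j"])
      (auto simp flip: binomial_symmetric)
  finally have E_f: "umbral (q_Euler q) f
      = (\<Sum>l = 0..m. of_nat (m choose l) * (- 1) ^ (m - l) * q_Euler q (l + k))" .
  have "(\<Sum>j = 0..max k m. (q * of_nat (k choose j) + (- 1) ^ j * of_nat (m choose j))
        * ?S (k + m - j)) = q * umbral ?S (f \<circ>\<^sub>p [:1, 1:]) + umbral ?S f"
    unfolding L_shift L_f by (simp add: sum_distrib_left sum.distrib algebra_simps)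
  also have "\<dots> = (1 + q) * umbral (q_Euler q) f"
    by (rule umbral_square_q_Euler_shift)
  finally show ?thesis
    unfolding E_f umbral_square_def .
qed

end
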